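(* Let $\mathcal{I}=\{I_m\}_{m\in\mathbb{N}}$ and $\mathcal{J}=\{J_m\}_{m\in\mathbb{N}}$ be discrete valued filtrations of a Noetherian ring $R$, where $I_m=\bigcap_{i=1}^s I(v_i)_{a_im}$ and $J_m=\bigcap_{i=1}^r I(v_i')_{a_i'm}$ for all $m\in\mathbb{N}$ are irredundant representations (with $v_i, v_i'$ discrete valuations of $R$ and $a_i,a_i'\in\mathbb{R}_{>0}$). If $\overline{\nu}_{\mathcal{I}}=\overline{\nu}_{\mathcal{J}}$, then $r=s$ and, after reindexing, $a_i=a_i'$ and $v_i=v_i'$ for all $i$.
   Context: Rings are commutative with identity, and $\mathbb{N}$ denotes the nonnegative integers. A filtration of a ring $R$ is a family $\mathcal{I} = \{I_m\}_{m\in\mathbb{N}}$ of ideals of $R$ with $I_0 = R$, $I_n \supseteq I_{n+1}$ and $I_n I_m \subseteq I_{n+m}$ for all $m,n \in \mathbb{N}$. The order of $\mathcal{I}$ is $\nu_{\mathcal{I}}(f) = \sup\{m \mid f \in I_m\} \in \mathbb{N}\cup\{\infty\}$ for $f \in R$. The asymptotic Samuel function of $\mathcal{I}$ is $\overline{\nu}_{\mathcal{I}} : R \to \mathbb{R}_{\ge 0}\cup\{\infty\}$, $\overline{\nu}_{\mathcal{I}}(x) = \lim_{n\to\infty} \nu_{\mathcal{I}}(x^n)/n$ (this limit always exists in $\mathbb{R}_{\ge 0}\cup\{\infty\}$). A discrete valuation of $R$ is a map $v: R\to\mathbb{Z}\cup\{\infty\}$ obtained as follows: there are a minimal prime $P$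 of $R$ and a rank 1 discrete valuation $v$ of the quotient field $\kappa(P)$ of $R/P$, with value group identified with $\mathbb{Z}$ (so $v$ is surjective from $\kappa(P)^{\times}$ onto $\mathbb{Z}$), nonnegative on $R/P$; for $r\in R$ set $v(r)$ to be the value of the image of $r$ in $R/P$ if $r\notin P$, and $v(r)=\infty$ if $r\in P$. For $c\in\mathbb{R}_{\ge0}$, $I(v)_c = \{f\in R\mid v(f)\ge c\}$. A discrete valued filtration of $R$ is a filtration $\{I_m\}_{m\in\mathbb{N}}$ for which there are $s\geq 1$, discrete valuations $v_1,\ldots,v_s$ of $R$ and $a_1,\ldots,a_s\in\mathbb{R}_{>0}$ with $I_m = \bigcap_{i=1}^s I(v_i)_{a_im}$ for all $m\in\mathbb{N}$. Such a representation is irredundant if for each $i\in\{1,\ldots,s\}$ there is some $m$ for which the equality for $I_m$ fails when the term $I(v_i)_{a_im}$ is removed from the intersection. *)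

theory Defs
  imports
    "HOL-Algebra.Ring_Divisibility"
    "HOL-Algebra.Ideal_Product"
    "HOL-Algebra.QuotRing"
    "HOL-Library.Extended_Real"
begin

section \<open>Field of fractions\<close>

definition frac_rel :: "('a, 'b) ring_scheme \<Rightarrow> (('a \<times> 'a) \<times> ('a \<times> 'a)) set" where
  "frac_rel D = {((a, b), (c, d)). a \<in> carrier D \<and> b \<in> carrier D - {\<zero>\<^bsub>D\<^esub>} \<and>
     c \<in> carrier D \<and> d \<in> carrier D - {\<zero>\<^bsub>D\<^esub>} \<and> a \<otimes>\<^bsub>D\<^esub> d = c \<otimes>\<^bsub>D\<^esub> b}"

definition fraction :: "('a, 'b) ring_scheme \<Rightarrow> 'a \<Rightarrow> 'a \<Rightarrow> ('a \<times> 'a) set" where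
  "fraction D a b = frac_rel D `` {(a, b)}"

definition frac_field :: "('a, 'b) ring_scheme \<Rightarrow> ('a \<times> 'a) set ring" where
  "frac_field D =
     \<lparr> carrier = (carrier D \<times> (carrier D - {\<zero>\<^bsub>D\<^esub>})) // frac_rel D,
       mult = (\<lambda>X Y. \<Union>(a, b)\<in>X. \<Union>(c, d)\<in>Y. fraction D (a \<otimes>\<^bsub>D\<^esub> c) (b \<otimes>\<^bsub>D\<^esub> d)),
       one = fraction D \<one>\<^bsub>D\<^esub> \<one>\<^bsub>D\<^esub>,
       zero = fraction D \<zero>\<^bsub>D\<^esub> \<one>\<^bsub>D\<^esub>,
       add = (\<lambda>X Y. \<Union>(a, b)\<in>X. \<Union>(c, d)\<in>Y.
                fraction D (a \<otimes>\<^bsub>D\<^esub> d \<oplus>\<^bsub>D\<^esub> c \<otimes>\<^bsub>D\<^esub> b) (b \<otimes>\<^bsub>D\<^esub> d)) \<rparr>"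

lemma UN_UN_eq:
  assumes "(a, b) \<in> X" "(c, d) \<in> Y"
    and "\<And>a b c d. (a, b) \<in> X \<Longrightarrow> (c, d) \<in> Y \<Longrightarrow> f a b c d = Z"
  shows "(\<Union>(a, b)\<in>X. \<Union>(c, d)\<in>Y. f a b c d) = Z"
proof -
  have "(\<Union>(a, b)\<in>X. \<Union>(c, d)\<in>Y. f a b c d) = (\<Union>(a, b)\<in>X. \<Union>(c, d)\<in>Y. Z)"
    by (intro SUP_cong refl) (auto simp: assms(3))
  also have "\<dots> = Z"
    using assms(1,2) by auto
  finally show ?thesis .
qed

context domain
begin

lemma equiv_frac_rel: "equiv (carrier R \<times> (carrier R - {\<zero>})) (frac_rel R)"
proof (rule equivI)
  show "frac_rel R \<subseteq> (carrier R \<times> (carrier R - {\<zero>})) \<times> (carrier R \<times> (carrier R - {\<zero>}))"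
    by (auto simp: frac_rel_def)
  show "refl_on (carrier R \<times> (carrier R - {\<zero>})) (frac_rel R)"
    by (auto simp: frac_rel_def refl_on_def)
  show "sym (frac_rel R)"
    by (auto simp: frac_rel_def sym_def)
  have "a \<otimes> f = e \<otimes> b"
    if c: "a \<in> carrier R" "b \<in> carrier R" "c \<in> carrier R" "d \<in> carrier R" "e \<in> carrier R"
      "f \<in> carrier R" and n: "d \<noteq> \<zero>" and e: "a \<otimes> d = c \<otimes> b" "c \<otimes> f = e \<otimes> d"
    for a b c d e f
  proof -
    have "d \<otimes> (a \<otimes> f) = (a \<otimes> d) \<otimes> f" using c by algebra
    also have "\<dots> = (c \<otimes> f) \<otimes> b" unfolding e(1) using c by algebra
    also have "\<dots> = d \<otimes> (e \<otimes> b)" unfolding e(2) using c by algebra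
    finally have "d \<otimes> (a \<otimes> f) = d \<otimes> (e \<otimes> b)" .
    moreover have "a \<otimes> f \<in> carrier R" "e \<otimes> b \<in> carrier R"
      using c by blast+
    ultimately show ?thesis
      using m_lcancel[OF n c(4)] by blast
  qed
  note frac_trans = this
  show "trans (frac_rel R)"
  proof (rule transI)
    fix x y z
    assume xy: "(x, y) \<in> frac_rel R" and yz: "(y, z) \<in> frac_rel R"
    obtain a b c d e f where [simp]: "x = (a, b)" "y = (c, d)" "z = (e, f)"
      by (cases x, cases y, cases z)
    have "a \<otimes> f = e \<otimes> b"
      by (rule frac_trans[of a b c d e f]) (use xy yz in \<open>simp_all add: frac_rel_def\<close>)
    then show "(x, z) \<in> frac_rel R"
      using xy yz by (simp add: frac_rel_def)
  qed
qed

lemma fraction_eq_iff: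
  assumes "a \<in> carrier R" "b \<in> carrier R" "b \<noteq> \<zero>"
    and "c \<in> carrier R" "d \<in> carrier R" "d \<noteq> \<zero>"
  shows "fraction R a b = fraction R c d \<longleftrightarrow> a \<otimes> d = c \<otimes> b"
  unfolding fraction_def using assms
  by (subst eq_equiv_class_iff[OF equiv_frac_rel]) (auto simp: frac_rel_def)

lemma fraction_closed [simp]:
  assumes "a \<in> carrier R" "b \<in> carrier R" "b \<noteq> \<zero>"
  shows "fraction R a b \<in> carrier (frac_field R)"
  using assms by (auto simp: frac_field_def fraction_def intro: quotientI)

lemma fraction_cases:
  assumes "X \<in> carrier (frac_field R)"
  obtains a b where "a \<in> carrier R" "b \<in> carrier R" "b \<noteq> \<zero>" "X = fraction R a b"
  using assms by (auto simp: frac_field_def fraction_def elim!: quotientE)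

lemma fraction_mult:
  assumes "a \<in> carrier R" "b \<in> carrier R" "b \<noteq> \<zero>"
    and "c \<in> carrier R" "d \<in> carrier R" "d \<noteq> \<zero>"
  shows "fraction R a b \<otimes>\<^bsub>frac_field R\<^esub> fraction R c d = fraction R (a \<otimes> c) (b \<otimes> d)"
proof -
  have eq: "fraction R (a' \<otimes> c') (b' \<otimes> d') = fraction R (a \<otimes> c) (b \<otimes> d)"
    if "((a, b), (a', b')) \<in> frac_rel R" "((c, d), (c', d')) \<in> frac_rel R" for a' b' c' d'
  proof -
    from that have c: "a' \<in> carrier R" "b' \<in> carrier R" "b' \<noteq> \<zero>" "c' \<in> carrier R"
      "d' \<in> carrier R" "d' \<noteq> \<zero>" and e: "a \<otimes> b' = a' \<otimes> b" "c \<otimes> d' = c' \<otimes> d"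
      by (auto simp: frac_rel_def)
    have "(a' \<otimes> c') \<otimes> (b \<otimes> d) = (a' \<otimes> b) \<otimes> (c' \<otimes> d)" using c assms by algebra
    also have "\<dots> = (a \<otimes> b') \<otimes> (c \<otimes> d')" using e by simp
    also have "\<dots> = (a \<otimes> c) \<otimes> (b' \<otimes> d')" using c assms by algebra
    finally show ?thesis using c assms by (subst fraction_eq_iff) (auto simp: integral_iff)
  qed
  have mem: "(a, b) \<in> fraction R a b" "(c, d) \<in> fraction R c d"
    using assms by (auto simp: fraction_def frac_rel_def)
  show ?thesis
    unfolding frac_field_def monoid.simps ring.simps by (rule UN_UN_eq[OF mem], rule eq) (simp_all add: fraction_def)
qed

lemma fraction_add:
  assumes "a \<in> carrier R" "b \<in> carrier R" "b \<noteq> \<zero>"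
    and "c \<in> carrier R" "d \<in> carrier R" "d \<noteq> \<zero>"
  shows "fraction R a b \<oplus>\<^bsub>frac_field R\<^esub> fraction R c d = fraction R (a \<otimes> d \<oplus> c \<otimes> b) (b \<otimes> d)"
proof -
  have eq: "fraction R (a' \<otimes> d' \<oplus> c' \<otimes> b') (b' \<otimes> d') = fraction R (a \<otimes> d \<oplus> c \<otimes> b) (b \<otimes> d)"
    if "((a, b), (a', b')) \<in> frac_rel R" "((c, d), (c', d')) \<in> frac_rel R" for a' b' c' d'
  proof -
    from that have c: "a' \<in> carrier R" "b' \<in> carrier R" "b' \<noteq> \<zero>" "c' \<in> carrier R"
      "d' \<in> carrier R" "d' \<noteq> \<zero>" and e: "a \<otimes> b' = a' \<otimes> b" "c \<otimes> d' = c' \<otimes> d"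
      by (auto simp: frac_rel_def)
    have "(a' \<otimes> d' \<oplus> c' \<otimes> b') \<otimes> (b \<otimes> d)
        = (a' \<otimes> b) \<otimes> (d \<otimes> d') \<oplus> (c' \<otimes> d) \<otimes> (b \<otimes> b')"
      using c assms by (simp add: l_distr r_distr m_ac)
    also have "\<dots> = (a \<otimes> b') \<otimes> (d \<otimes> d') \<oplus> (c \<otimes> d') \<otimes> (b \<otimes> b')" using e by simp
    also have "\<dots> = (a \<otimes> d \<oplus> c \<otimes> b) \<otimes> (b' \<otimes> d')"
      using c assms by (simp add: l_distr r_distr m_ac)
    finally show ?thesis using c assms by (subst fraction_eq_iff) (auto simp: integral_iff)
  qed
  have mem: "(a, b) \<in> fraction R a b" "(c, d) \<in> fraction R c d"
    using assms by (auto simp: fraction_def frac_rel_def)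
  show ?thesis
    unfolding frac_field_def monoid.simps ring.simps by (rule UN_UN_eq[OF mem], rule eq) (simp_all add: fraction_def)
qed

lemma zero_frac_field: "\<zero>\<^bsub>frac_field R\<^esub> = fraction R \<zero> \<one>"
  and one_frac_field: "\<one>\<^bsub>frac_field R\<^esub> = fraction R \<one> \<one>"
  by (simp_all add: frac_field_def)

theorem field_frac_field: "field (frac_field R)"
proof (rule cring.cring_fieldI2)
  note [simp] = fraction_mult fraction_add zero_frac_field one_frac_field integral_iff
  show "cring (frac_field R)"
  proof (intro cringI abelian_groupI comm_monoidI, goal_cases)
    case (1 x y) then show ?case by (auto elim!: fraction_cases)
  next
    case 2 then show ?case by simp
  next
    case (3 x y z) then show ?case
      by (elim fraction_cases) (simp add: fraction_eq_iff l_distr r_distr m_ac a_ac)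
  next
    case (4 x y) then show ?case
      by (elim fraction_cases) (simp add: fraction_eq_iff l_distr r_distr m_ac a_ac)
  next
    case (5 x) then show ?case by (auto elim!: fraction_cases)
  next
    case (6 x)
    then obtain a b where "a \<in> carrier R" "b \<in> carrier R" "b \<noteq> \<zero>" "x = fraction R a b"
      by (elim fraction_cases)
    then show ?case
      apply (intro bexI[of _ "fraction R (\<ominus> a) b"])
       apply (simp_all add: fraction_eq_iff)
      apply algebra
      done
  next
    case (7 x y) then show ?case by (auto elim!: fraction_cases)
  next
    case 8 then show ?case by simp
  next
    case (9 x y z) then show ?case
      by (elim fraction_cases) (simp add: fraction_eq_iff m_assoc)
  next
    case (10 x) then show ?case by (auto elim!: fraction_cases)
  next
    case (11 x y) then show ?case
      by (elim fraction_cases) (simp add: fraction_eq_iff m_comm)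
  next
    case (12 x y z) then show ?case
      by (elim fraction_cases) (simp add: fraction_eq_iff l_distr r_distr m_ac a_ac)
  qed
  show "\<zero>\<^bsub>frac_field R\<^esub> \<noteq> \<one>\<^bsub>frac_field R\<^esub>"
    by (simp add: fraction_eq_iff)
  show "\<exists>y\<in>carrier (frac_field R). x \<otimes>\<^bsub>frac_field R\<^esub> y = \<one>\<^bsub>frac_field R\<^esub>"
    if "x \<in> carrier (frac_field R)" "x \<noteq> \<zero>\<^bsub>frac_field R\<^esub>" for x
  proof -
    from that(1) obtain a b where ab: "a \<in> carrier R" "b \<in> carrier R" "b \<noteq> \<zero>" "x = fraction R a b"
      by (elim fraction_cases)
    with that(2) have "a \<noteq> \<zero>" by (auto simp: fraction_eq_iff)
    with ab show ?thesis
      by (intro bexI[of _ "fraction R b a"]) (auto simp: fraction_eq_iff m_comm)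
  qed
qed

end

section \<open>Filtrations and the asymptotic Samuel function\<close>

definition filtration :: "('a, 'b) ring_scheme \<Rightarrow> (nat \<Rightarrow> 'a set) \<Rightarrow> bool" where
  "filtration R I \<longleftrightarrow>
     (\<forall>m. ideal (I m) R) \<and> I 0 = carrier R \<and> (\<forall>n. I (Suc n) \<subseteq> I n) \<and>
     (\<forall>m n. I n \<cdot>\<^bsub>R\<^esub> I m \<subseteq> I (n + m))"

definition filtration_order :: "(nat \<Rightarrow> 'a set) \<Rightarrow> 'a \<Rightarrow> enat" where
  "filtration_order I f = Sup (enat ` {m. f \<in> I m})"

definition asymptotic_samuel :: "('a, 'b) ring_scheme \<Rightarrow> (nat \<Rightarrow> 'a set) \<Rightarrow> 'a \<Rightarrow> ereal" where
  "asymptotic_samuel R I x =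
     lim (\<lambda>n. ereal_of_enat (filtration_order I (x [^]\<^bsub>R\<^esub> n)) / ereal (real n))"

section \<open>Discrete valuations and discrete valued filtrations\<close>

definition minimal_prime :: "('a, 'b) ring_scheme \<Rightarrow> 'a set \<Rightarrow> bool" where
  "minimal_prime R P \<longleftrightarrow> primeideal P R \<and> (\<forall>Q. primeideal Q R \<and> Q \<subseteq> P \<longrightarrow> Q = P)"

text \<open>Rank 1 discrete valuations of a field with value group equal to the integers. Only the
  values at nonzero elements are meaningful; the value infinity at zero is added in
  \<^term>\<open>discrete_valuation\<close> below.\<close>

definition field_discrete_valuation :: "('k, 'b) ring_scheme \<Rightarrow> ('k \<Rightarrow> int) \<Rightarrow> bool" where
  "field_discrete_valuation K w \<longleftrightarrow>
     (\<forall>x \<in> carrier K - {\<zero>\<^bsub>K\<^esub>}. \<forall>y \<in> carrier K - {\<zero>\<^bsub>K\<^esub>}. w (x \<otimes>\<^bsub>K\<^esub> y) = w x + w y) \<and>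
     (\<forall>x \<in> carrier K - {\<zero>\<^bsub>K\<^esub>}. \<forall>y \<in> carrier K - {\<zero>\<^bsub>K\<^esub>}.
        x \<oplus>\<^bsub>K\<^esub> y \<noteq> \<zero>\<^bsub>K\<^esub> \<longrightarrow> min (w x) (w y) \<le> w (x \<oplus>\<^bsub>K\<^esub> y)) \<and>
     w ` (carrier K - {\<zero>\<^bsub>K\<^esub>}) = UNIV"

text \<open>A discrete valuation is a map into the integers with infinity, viewed inside
  \<^typ>\<open>ereal\<close>; it is meaningful on the carrier only. The residue class of \<open>r\<close> is the
  coset \<open>P +> r\<close>.\<close>

definition discrete_valuation :: "('a, 'b) ring_scheme \<Rightarrow> ('a \<Rightarrow> ereal) \<Rightarrow> bool" where
  "discrete_valuation R v \<longleftrightarrow>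
     (\<exists>P w. minimal_prime R P \<and>
        field_discrete_valuation (frac_field (R Quot P)) w \<and>
        (\<forall>a \<in> carrier (R Quot P) - {\<zero>\<^bsub>R Quot P\<^esub>}. 0 \<le> w (fraction (R Quot P) a \<one>\<^bsub>R Quot P\<^esub>)) \<and>
        (\<forall>r \<in> carrier R. v r =
           (if r \<in> P then \<infinity>
            else ereal (real_of_int (w (fraction (R Quot P) (P +>\<^bsub>R\<^esub> r) \<one>\<^bsub>R Quot P\<^esub>))))))"

definition valuation_ideal :: "('a, 'b) ring_scheme \<Rightarrow> ('a \<Rightarrow> ereal) \<Rightarrow> real \<Rightarrow> 'a set" where
  "valuation_ideal R v c = {f \<in> carrier R. ereal c \<le> v f}"

text \<open>Intersecting with the carrier makes the empty intersection the unit ideal, which is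
  the convention needed for irredundancy of representations with a single term.\<close>

definition valuation_inter ::
    "('a, 'b) ring_scheme \<Rightarrow> nat set \<Rightarrow> (nat \<Rightarrow> 'a \<Rightarrow> ereal) \<Rightarrow> (nat \<Rightarrow> real) \<Rightarrow> nat \<Rightarrow> 'a set" where
  "valuation_inter R S v a m = carrier R \<inter> (\<Inter>i\<in>S. valuation_ideal R (v i) (a i * real m))"

definition dv_representation ::
    "('a, 'b) ring_scheme \<Rightarrow> (nat \<Rightarrow> 'a set) \<Rightarrow> nat \<Rightarrow> (nat \<Rightarrow> 'a \<Rightarrow> ereal) \<Rightarrow> (nat \<Rightarrow> real) \<Rightarrow> bool"
where
  "dv_representation R I s v a \<longleftrightarrow>
     1 \<le> s \<and> (\<forall>i\<in>{1..s}. discrete_valuation R (v i) \<and> 0 < a i) \<and>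
     (\<forall>m. I m = valuation_inter R {1..s} v a m)"

definition irredundant_dv_representation ::
    "('a, 'b) ring_scheme \<Rightarrow> (nat \<Rightarrow> 'a set) \<Rightarrow> nat \<Rightarrow> (nat \<Rightarrow> 'a \<Rightarrow> ereal) \<Rightarrow> (nat \<Rightarrow> real) \<Rightarrow> bool"
where
  "irredundant_dv_representation R I s v a \<longleftrightarrow>
     dv_representation R I s v a \<and>
     (\<forall>i\<in>{1..s}. \<exists>m. I m \<noteq> valuation_inter R ({1..s} - {i}) v a m)"

definition discrete_valued_filtration :: "('a, 'b) ring_scheme \<Rightarrow> (nat \<Rightarrow> 'a set) \<Rightarrow> bool" where
  "discrete_valued_filtration R I \<longleftrightarrow> filtration R I \<and> (\<exists>s v a. dv_representation R I s v a)"

end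

theory Submission
  imports Defs
begin

text \<open>
  Put \<open>w\<^sub>i = v\<^sub>i / a\<^sub>i\<close>. The asymptotic Samuel function is \<open>\<phi> = min\<^sub>i w\<^sub>i\<close>, and irredundancy gives,
  for each \<open>i\<close>, an element \<open>x\<close> with \<open>w\<^sub>i x < w\<^sub>k x\<close> for all \<open>k \<noteq> i\<close>. Let \<open>\<phi> = min\<^sub>j w'\<^sub>j\<close> be a
  second representation and let \<open>T\<close> be the set of all \<open>j\<close> with \<open>w'\<^sub>j x = \<phi> x\<close>. Comparing the two
  minima at \<open>x\<^sup>n y\<close> for large \<open>n\<close> shows that \<open>w\<^sub>i\<close> is the minimum of the \<open>w'\<^sub>j\<close> with \<open>j \<in> T\<close>. As
  \<open>w\<^sub>i\<close> is multiplicative, it equals one of them: otherwise choose \<open>y\<^sub>j\<close> with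
  \<open>w\<^sub>i y\<^sub>j < w'\<^sub>j y\<^sub>j\<close> and evaluate at the product of the \<open>y\<^sub>j\<close>. Finally \<open>a\<^sub>i\<close> is determined by
  \<open>w\<^sub>i\<close>, since \<open>v\<^sub>i\<close> has value group \<open>\<int>\<close>.
\<close>

section \<open>Comparing homomorphisms from a monoid to the extended nonnegative reals\<close>

text \<open>The normalisation at \<open>\<one>\<close> excludes the map with constant value
  \<infinity>. The intended instances are \<open>w\<^sub>i = v\<^sub>i / a\<^sub>i\<close> on the
  multiplicative monoid of \<open>R\<close>.\<close>

definition ereal_valued_hom :: "('a, 'b) monoid_scheme \<Rightarrow> ('a \<Rightarrow> ereal) \<Rightarrow> bool" where
  "ereal_valued_hom G w \<longleftrightarrow> w \<one>\<^bsub>G\<^esub> = 0 \<and> (\<forall>x\<in>carrier G. 0 \<le> w x) \<and>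
     (\<forall>x\<in>carrier G. \<forall>y\<in>carrier G. w (x \<otimes>\<^bsub>G\<^esub> y) = w x + w y)"

lemma ereal_valued_homD:
  assumes "ereal_valued_hom G w"
  shows "w \<one>\<^bsub>G\<^esub> = 0" "x \<in> carrier G \<Longrightarrow> 0 \<le> w x"
    "x \<in> carrier G \<Longrightarrow> y \<in> carrier G \<Longrightarrow> w (x \<otimes>\<^bsub>G\<^esub> y) = w x + w y"
  using assms by (auto simp: ereal_valued_hom_def)

context comm_monoid
begin

lemma ereal_valued_hom_pow:
  assumes "ereal_valued_hom G w" "x \<in> carrier G"
  shows "w (x [^] (n::nat)) = ereal (real n) * w x"
proof (induction n)
  case 0
  \<comment> \<open>If \<open>w x = \<infinity>\<close>, this case relies on the convention
    \<open>0 * \<infinity> = 0\<close> in \<open>ereal\<close>.\<close>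
  then show ?case using ereal_valued_homD[OF assms(1)] by (simp add: zero_ereal_def[symmetric])
next
  case (Suc n)
  have "ereal (real (Suc n)) * w x = ereal (real n) * w x + ereal 1 * w x"
    by (subst ereal_left_distrib[symmetric]) (auto simp: add.commute)
  then show ?case using Suc assms by (simp add: ereal_valued_homD(3)[OF assms(1)])
qed

text \<open>At \<open>x [^] n \<otimes> y\<close> each map has the value slope times
  \<open>n\<close> plus intercept, where the slope is its value at \<open>x\<close> and the
  intercept its value at \<open>y\<close>. For large \<open>n\<close> such sequences compare
  lexicographically, first by slope, then by intercept.\<close>

lemma eventually_hom_less:
  assumes w: "ereal_valued_hom G w" and u: "ereal_valued_hom G u"
    and x: "x \<in> carrier G" and y: "y \<in> carrier G"
    and fin: "w x < \<infinity>" "w y < \<infinity>"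
    and less: "w x < u x \<or> w x = u x \<and> w y < u y"
  shows "\<forall>\<^sub>F n in sequentially. w (x [^] n \<otimes> y) < u (x [^] n \<otimes> y)"
proof -
  have nonneg: "0 \<le> w x" "0 \<le> w y" "0 \<le> u x" "0 \<le> u y"
    using ereal_valued_homD(2)[OF w] ereal_valued_homD(2)[OF u] x y by auto
  obtain p q where pq: "w x = ereal p" "w y = ereal q"
    using fin nonneg by (cases "w x"; cases "w y") auto
  have w_eq: "w (x [^] n \<otimes> y) = ereal (real n * p + q)" for n :: nat
    using ereal_valued_homD(3)[OF w] ereal_valued_hom_pow[OF w] x y pq by simp
  have u_eq: "u (x [^] n \<otimes> y) = ereal (real n) * u x + u y" for n :: nat
    using ereal_valued_homD(3)[OF u] ereal_valued_hom_pow[OF u] x y by simp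
  show ?thesis
  proof (cases "u x")
    case PInf
    \<comment> \<open>At \<open>n = 0\<close> the infinite slope would be lost, as
      \<open>0 * \<infinity> = 0\<close>.\<close>
    have "\<forall>\<^sub>F n in sequentially. n > 0" by (rule eventually_gt_at_top)
    then show ?thesis
      by eventually_elim (use PInf nonneg(4) in \<open>simp add: w_eq u_eq\<close>)
  next
    case (real t)
    show ?thesis
    proof (cases "p < t")
      case True
      \<comment> \<open>Beyond \<open>q / (t - p)\<close> the line \<open>n * p + q\<close> lies
        below \<open>n * t\<close>; the intercept \<open>u y\<close>, possibly infinite, can only
        raise the right-hand side.\<close>
      obtain N :: nat where N: "q / (t - p) < real N" using reals_Archimedean2 by blast
      have "\<forall>\<^sub>F n in sequentially. n \<ge> N" by (rule eventually_ge_at_top)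
      then show ?thesis
      proof eventually_elim
        case (elim n)
        have "q / (t - p) < real n" using N elim by linarith
        then have "real n * p + q < real n * t" using True by (simp add: field_simps)
        then have "ereal (real n * p + q) < ereal (real n * t) + 0" by simp
        also have "\<dots> \<le> ereal (real n * t) + u y" using nonneg by (intro add_left_mono) auto
        finally show ?case by (simp add: w_eq u_eq real)
      qed
    next
      case False
      \<comment> \<open>Here the slopes agree, so the intercepts decide, for every
        \<open>n\<close>.\<close>
      then show ?thesis using less pq real by (cases "u y") (auto simp: w_eq u_eq)
    qed
  qed (use nonneg in auto)
qed

text \<open>Each \<open>u j\<close> exceeds \<open>w\<close> at some element of its own, and
  multiplying these elements adds the inequalities. The weak inequality \<open>le\<close> at the
  other factors keeps a strict one strict because the values of \<open>w\<close> involved are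
  finite.\<close>

lemma hom_less_at_product:
  assumes "finite S" and w: "ereal_valued_hom G w"
    and u: "\<And>j. j \<in> S \<Longrightarrow> ereal_valued_hom G (u j)"
    and le: "\<And>j y. j \<in> S \<Longrightarrow> y \<in> carrier G \<Longrightarrow> w y \<le> u j y"
    and ne: "\<And>j. j \<in> S \<Longrightarrow> \<exists>y\<in>carrier G. w y \<noteq> u j y"
  shows "\<exists>y\<in>carrier G. w y < \<infinity> \<and> (\<forall>j\<in>S. w y < u j y)"
  using assms(1) u le ne
proof (induction S)
  case empty
  then show ?case using ereal_valued_homD(1)[OF w] by (intro bexI[of _ \<one>]) auto
next
  case (insert k S)
  obtain y where y: "y \<in> carrier G" "w y < \<infinity>" "\<And>j. j \<in> S \<Longrightarrow> w y < u j y"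
    using insert.IH insert.prems by (metis insertCI)
  obtain z where z: "z \<in> carrier G" "w z < u k z"
    using insert.prems(2,3)[of k] by (metis insertI1 order_le_less)
  have fin: "\<bar>w y\<bar> \<noteq> \<infinity>" "\<bar>w z\<bar> \<noteq> \<infinity>"
    using ereal_valued_homD(2)[OF w y(1)] ereal_valued_homD(2)[OF w z(1)] y z by auto
  have "w (y \<otimes> z) < u j (y \<otimes> z)" if j: "j \<in> insert k S" for j
  proof -
    have "w y \<le> u j y" "w z \<le> u j z" using insert.prems(2) j y z by auto
    moreover have "w y < u j y \<or> w z < u j z" using j y z by auto
    ultimately have "w y + w z < u j y + u j z"
      using fin by (cases "w y"; cases "w z"; cases "u j y"; cases "u j z") auto
    then show ?thesis
      using ereal_valued_homD(3)[OF w] ereal_valued_homD(3)[OF insert.prems(1)[OF j]] y z by simp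
  qed
  then show ?case using y z fin ereal_valued_homD(3)[OF w]
    by (intro bexI[of _ "y \<otimes> z"]) auto
qed

text \<open>\<open>wu\<close> and \<open>uw\<close> say without \<open>Min\<close> that both
  families have the same pointwise minimum; at \<open>x\<close> it is attained by \<open>w i\<close>
  alone. Testing at \<open>x [^] n \<otimes> y\<close> for large \<open>n\<close> reduces the
  comparison to those \<open>u j\<close> that tie with \<open>w i\<close> at
  \<open>x\<close>.\<close>

lemma strict_minimum_hom_in_family:
  assumes fin: "finite A" "finite B" and i: "i \<in> A"
    and w: "\<And>i. i \<in> A \<Longrightarrow> ereal_valued_hom G (w i)"
    and u: "\<And>j. j \<in> B \<Longrightarrow> ereal_valued_hom G (u j)"
    and wu: "\<And>i z. i \<in> A \<Longrightarrow> z \<in> carrier G \<Longrightarrow> \<exists>j\<in>B. u j z \<le> w i z"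
    and uw: "\<And>j z. j \<in> B \<Longrightarrow> z \<in> carrier G \<Longrightarrow> \<exists>i\<in>A. w i z \<le> u j z"
    and x: "x \<in> carrier G" "w i x < \<infinity>" "\<And>k. k \<in> A - {i} \<Longrightarrow> w i x < w k x"
  shows "\<exists>j\<in>B. \<forall>y\<in>carrier G. u j y = w i y"
proof (rule ccontr)
  assume contra: "\<not> ?thesis"
  define T where "T = {j \<in> B. u j x = w i x}"
  have ge: "w i x \<le> u j x" if j: "j \<in> B" for j
  proof -
    obtain k where "k \<in> A" "w k x \<le> u j x" using uw[OF j x(1)] by blast
    then show ?thesis using x(3)[of k] by (cases "k = i") auto
  qed
  have le: "w i y \<le> u j y" if j: "j \<in> T" and y: "y \<in> carrier G" for j y
  proof (rule ccontr)
    assume less: "\<not> w i y \<le> u j y"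
    have jB: "j \<in> B" "u j x = w i x" using j by (auto simp: T_def)
    \<comment> \<open>For \<open>k = i\<close> the slopes tie and \<open>y\<close> decides; for
      \<open>k \<noteq> i\<close> the slope of \<open>w k\<close> is already larger. So
      \<open>u j\<close> would lie strictly below the whole family \<open>w\<close> at one element,
      against \<open>uw\<close>.\<close>
    have "\<forall>\<^sub>F n in sequentially. u j (x [^] n \<otimes> y) < w k (x [^] n \<otimes> y)" if "k \<in> A" for k
      using less jB x that by (intro eventually_hom_less u w y) (cases "k = i"; auto)+
    then have "\<forall>\<^sub>F n in sequentially. \<forall>k\<in>A. u j (x [^] n \<otimes> y) < w k (x [^] n \<otimes> y)"
      using fin by (simp add: eventually_ball_finite)
    then obtain n :: nat where "\<forall>k\<in>A. u j (x [^] n \<otimes> y) < w k (x [^] n \<otimes> y)"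
      using eventually_happens'[OF sequentially_bot] by blast
    then show False using uw[OF jB(1), of "x [^] n \<otimes> y"] x y by force
  qed
  \<comment> \<open>By the assumption to be refuted, \<open>w i\<close> differs from every
    \<open>u j\<close>, so a single product separates it from all \<open>j \<in> T\<close> at
    once.\<close>
  have "\<exists>y\<in>carrier G. w i y < \<infinity> \<and> (\<forall>j\<in>T. w i y < u j y)"
  proof (rule hom_less_at_product)
    show "\<exists>y\<in>carrier G. w i y \<noteq> u j y" if "j \<in> T" for j
      using contra that by (auto simp: T_def) metis
  qed (use fin u w i le in \<open>auto simp: T_def\<close>)
  then obtain y where y: "y \<in> carrier G" "w i y < \<infinity>" "\<And>j. j \<in> T \<Longrightarrow> w i y < u j y"
    by blast
  \<comment> \<open>Outside \<open>T\<close> the slope of \<open>u j\<close> is strictly larger;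
    inside \<open>T\<close> the slopes tie and \<open>y\<close> decides. Hence \<open>w i\<close>
    would lie strictly below all \<open>u j\<close> at one element, against
    \<open>wu\<close>.\<close>
  have "\<forall>\<^sub>F n in sequentially. w i (x [^] n \<otimes> y) < u j (x [^] n \<otimes> y)" if "j \<in> B" for j
  proof (rule eventually_hom_less)
    show "w i x < u j x \<or> w i x = u j x \<and> w i y < u j y"
      using ge[OF that] y(3)[of j] that by (auto simp: T_def)
  qed (use i u w x y that in auto)
  then have "\<forall>\<^sub>F n in sequentially. \<forall>j\<in>B. w i (x [^] n \<otimes> y) < u j (x [^] n \<otimes> y)"
    using fin by (simp add: eventually_ball_finite)
  then obtain n :: nat where "\<forall>j\<in>B. w i (x [^] n \<otimes> y) < u j (x [^] n \<otimes> y)"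
    using eventually_happens'[OF sequentially_bot] by blast
  then show False using wu[OF i, of "x [^] n \<otimes> y"] x y by force
qed

end

section \<open>Discrete valuations on the ring\<close>

text \<open>The value group is normalised on the quotient field of \<open>R / P\<close>, and
  \<open>R\<close> itself need not contain an element of value 1: on \<open>k[t^2, t^3]\<close> the
  order in \<open>t\<close> omits 1. Inside \<open>R\<close> the normalisation survives as a pair of
  finite values that differ by 1.\<close>

lemma (in cring) discrete_valuation_props:
  assumes "discrete_valuation R v"
  shows "ereal_valued_hom R v"
    and "\<And>x. x \<in> carrier R \<Longrightarrow> v x \<noteq> \<infinity> \<Longrightarrow> \<exists>k::int. v x = ereal (of_int k)"
    and "\<exists>b\<in>carrier R. \<exists>c\<in>carrier R. v c \<noteq> \<infinity> \<and> v b = v c + 1"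
proof -
  obtain P w where P: "minimal_prime R P"
    and w: "field_discrete_valuation (frac_field (R Quot P)) w"
    and w_nonneg: "\<forall>a \<in> carrier (R Quot P) - {\<zero>\<^bsub>R Quot P\<^esub>}.
      0 \<le> w (fraction (R Quot P) a \<one>\<^bsub>R Quot P\<^esub>)"
    and v: "\<forall>r \<in> carrier R. v r = (if r \<in> P then \<infinity>
      else ereal (real_of_int (w (fraction (R Quot P) (P +> r) \<one>\<^bsub>R Quot P\<^esub>))))"
    using assms unfolding discrete_valuation_def by blast
  let ?Q = "R Quot P"
  interpret P: primeideal P R using P by (simp add: minimal_prime_def)
  interpret Q: domain ?Q by (rule P.quotient_is_domain)
  \<comment> \<open>\<open>\<iota>\<close> is the canonical map from \<open>R\<close> to the field
    of fractions of \<open>R / P\<close>.\<close>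
  define \<iota> where "\<iota> = (\<lambda>r. fraction ?Q (P +> r) \<one>\<^bsub>?Q\<^esub>)"
  have coset: "P +> r \<in> carrier ?Q" if "r \<in> carrier R" for r
    using that by (auto simp: FactRing_def A_RCOSETS_def')
  have coset_cases: "\<exists>r\<in>carrier R. X = P +> r" if "X \<in> carrier ?Q" for X
    using that by (auto simp: FactRing_def A_RCOSETS_def')
  have coset_zero: "P +> r = \<zero>\<^bsub>?Q\<^esub> \<longleftrightarrow> r \<in> P" if "r \<in> carrier R" for r
    using P.a_rcos_const P.rcos_const_imp_mem that by (auto simp: FactRing_def)
  have coset_mult: "(P +> x) \<otimes>\<^bsub>?Q\<^esub> (P +> y) = P +> (x \<otimes> y)"
    if "x \<in> carrier R" "y \<in> carrier R" for x y
    using that by (simp add: FactRing_def P.rcoset_mult_add)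
  have \<iota>_mult: "\<iota> (x \<otimes> y) = \<iota> x \<otimes>\<^bsub>frac_field ?Q\<^esub> \<iota> y" if "x \<in> carrier R" "y \<in> carrier R" for x y
    using that by (simp add: \<iota>_def Q.fraction_mult coset coset_mult)
  have \<iota>_nonzero: "\<iota> x \<in> carrier (frac_field ?Q) - {\<zero>\<^bsub>frac_field ?Q\<^esub>}"
    if "x \<in> carrier R" "x \<notin> P" for x
    using that by (auto simp: \<iota>_def coset Q.zero_frac_field Q.fraction_eq_iff coset_zero)
  have w_mult: "w (X \<otimes>\<^bsub>frac_field ?Q\<^esub> Y) = w X + w Y"
    if "X \<in> carrier (frac_field ?Q) - {\<zero>\<^bsub>frac_field ?Q\<^esub>}"
      "Y \<in> carrier (frac_field ?Q) - {\<zero>\<^bsub>frac_field ?Q\<^esub>}" for X Y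
    using w that unfolding field_discrete_valuation_def by blast
  have v_in: "v r = \<infinity>" if "r \<in> P" for r
    using v that P.a_subset by auto
  have v_out: "v r = ereal (of_int (w (\<iota> r)))" if "r \<in> carrier R" "r \<notin> P" for r
    using v that by (simp add: \<iota>_def)
  have v_mult: "v (x \<otimes> y) = v x + v y" if xy: "x \<in> carrier R" "y \<in> carrier R" for x y
  proof (cases "x \<in> P \<or> y \<in> P")
    case True
    then have "x \<otimes> y \<in> P" using xy P.I_l_closed P.I_r_closed by auto
    moreover have "v x + v y = \<infinity>" using True v_in by auto
    ultimately show ?thesis by (simp add: v_in)
  next
    case False
    then have "x \<otimes> y \<notin> P" using P.I_prime xy by blast
    then show ?thesis using False xy by (simp add: v_out \<iota>_mult w_mult[OF \<iota>_nonzero \<iota>_nonzero])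
  qed
  have one: "\<one> \<notin> P" using P.I_notcarr P.one_imp_carrier by blast
  have v_nonneg: "0 \<le> v x" if "x \<in> carrier R" for x
    using w_nonneg that by (cases "x \<in> P") (auto simp: v_in v_out \<iota>_def coset coset_zero)
  have "v \<one> = v \<one> + v \<one>" using v_mult[of \<one> \<one>] by simp
  \<comment> \<open>\<open>v \<one>\<close> is finite because \<open>\<one>\<close> lies outside
    \<open>P\<close>, so it can be cancelled.\<close>
  then have "v \<one> = 0" using v_out[OF _ one] by simp
  then show "ereal_valued_hom R v"
    using v_mult v_nonneg by (simp add: ereal_valued_hom_def)
  \<comment> \<open>A uniformizer \<open>X\<close> is written as a quotient of the images of
    \<open>b\<close> and \<open>c\<close>; then \<open>v b - v c = w X = 1\<close>.\<close>
  have "1 \<in> w ` (carrier (frac_field ?Q) - {\<zero>\<^bsub>frac_field ?Q\<^esub>})"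
    using w by (simp add: field_discrete_valuation_def)
  then obtain X where "1 = w X" "X \<in> carrier (frac_field ?Q) - {\<zero>\<^bsub>frac_field ?Q\<^esub>}"
    by (rule imageE)
  then have X: "X \<in> carrier (frac_field ?Q)" "X \<noteq> \<zero>\<^bsub>frac_field ?Q\<^esub>" "w X = 1"
    by simp_all
  obtain b c where bc: "b \<in> carrier R" "c \<in> carrier R" "c \<notin> P"
    "X = fraction ?Q (P +> b) (P +> c)"
  proof -
    obtain \<beta> \<gamma> where "\<beta> \<in> carrier ?Q" "\<gamma> \<in> carrier ?Q" "\<gamma> \<noteq> \<zero>\<^bsub>?Q\<^esub>" "X = fraction ?Q \<beta> \<gamma>"
      using X(1) by (rule Q.fraction_cases)
    then show ?thesis using that coset_cases coset_zero by metis
  qed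
  have b: "b \<notin> P"
    using X(2) bc by (auto simp: coset coset_zero Q.zero_frac_field Q.fraction_eq_iff)
  have "X \<otimes>\<^bsub>frac_field ?Q\<^esub> \<iota> c = \<iota> b"
    using bc by (simp add: \<iota>_def coset coset_zero Q.fraction_mult Q.fraction_eq_iff Q.m_assoc)
  then have "w (\<iota> b) = 1 + w (\<iota> c)"
    using w_mult[of X "\<iota> c"] \<iota>_nonzero bc X by simp
  then have "v b = v c + 1" "v c \<noteq> \<infinity>"
    using b bc by (simp_all add: v_out one_ereal_def)
  then show "\<exists>b\<in>carrier R. \<exists>c\<in>carrier R. v c \<noteq> \<infinity> \<and> v b = v c + 1"
    using bc by blast
  show "\<exists>k::int. v x = ereal (of_int k)" if "x \<in> carrier R" "v x \<noteq> \<infinity>" for x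
    using v_in v_out that by blast
qed

text \<open>Two finite values of \<open>u\<close> differ by 1, so the common function
  \<open>u / b = v / a\<close> has two values differing by \<open>1 / b\<close>, while its finite
  values are integer multiples of \<open>1 / a\<close>. Hence \<open>a\<close> is an integer
  multiple of \<open>b\<close>, and by symmetry \<open>b\<close> is one of \<open>a\<close>.\<close>

lemma (in cring) discrete_valuation_proportional_imp_eq:
  assumes v: "discrete_valuation R v" and u: "discrete_valuation R u"
    and pos: "0 < a" "0 < b"
    and eq: "\<forall>x\<in>carrier R. u x / ereal b = v x / ereal a"
  shows "a = b"
proof -
  have step: "\<exists>k::int. c = d * of_int k"
    if v': "discrete_valuation R v'" and u': "discrete_valuation R u'"
      and pos': "0 < c" "0 < d" and eq': "\<forall>x\<in>carrier R. u' x / ereal d = v' x / ereal c"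
    for v' u' and c d :: real
  proof -
    obtain x y where xy: "x \<in> carrier R" "y \<in> carrier R" "u' y \<noteq> \<infinity>" "u' x = u' y + 1"
      using discrete_valuation_props(3)[OF u'] by blast
    obtain k l where kl: "u' x = ereal (of_int k)" "u' y = ereal (of_int l)"
    proof -
      have "u' x \<noteq> \<infinity>" using xy by (cases "u' y") auto
      then show ?thesis
        using that discrete_valuation_props(2)[OF u'] xy by blast
    qed
    have "v' z \<noteq> \<infinity>" if "z \<in> carrier R" "u' z \<noteq> \<infinity>" for z
    proof
      assume "v' z = \<infinity>"
      then have "u' z / ereal d = \<infinity>" using bspec[OF eq' that(1)] pos' by simp
      moreover have "0 \<le> u' z"
        using ereal_valued_homD(2)[OF discrete_valuation_props(1)[OF u'] that(1)] .
      ultimately show False using that(2) pos' by (cases "u' z") auto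
    qed
    then have "v' x \<noteq> \<infinity>" "v' y \<noteq> \<infinity>" using xy kl by auto
    then obtain m n where mn: "v' x = ereal (of_int m)" "v' y = ereal (of_int n)"
      using discrete_valuation_props(2)[OF v'] xy by blast
    have "real_of_int k / d = of_int m / c" "real_of_int l / d = of_int n / c"
      using bspec[OF eq' xy(1)] bspec[OF eq' xy(2)] pos' kl mn by auto
    moreover have "real_of_int k = of_int l + 1" using xy(4) kl by (simp add: one_ereal_def)
    ultimately have "c = d * of_int (m - n)"
      using pos' by (simp add: field_simps)
    then show ?thesis by blast
  qed
  obtain k :: int where k: "a = b * of_int k" using step[OF v u pos eq] by blast
  obtain l :: int where l: "b = a * of_int l"
    using step[OF u v pos(2,1)] eq by metis
  have "0 < k" "0 < l" using k l pos by (metis of_int_0_less_iff zero_less_mult_pos)+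
  \<comment> \<open>Positive integers are at least 1, which gives \<open>b \<le> a\<close> and
    \<open>a \<le> b\<close>.\<close>
  then have "b * 1 \<le> b * of_int k" "a * 1 \<le> a * of_int l"
    using pos by (intro mult_left_mono; simp)+
  then show ?thesis using k l by linarith
qed

section \<open>Computing the asymptotic Samuel function\<close>

lemma tendsto_floor_mult_over:
  fixes c :: real
  shows "(\<lambda>n. of_int \<lfloor>real n * c\<rfloor> / real n) \<longlonglongrightarrow> c"
proof (rule real_tendsto_sandwich)
  show "(\<lambda>n. c - 1 / real n) \<longlonglongrightarrow> c"
    using tendsto_diff[OF tendsto_const lim_1_over_n, of c] by simp
  show "\<forall>\<^sub>F n in sequentially. c - 1 / real n \<le> of_int \<lfloor>real n * c\<rfloor> / real n"
    using eventually_gt_at_top[of 0]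
  proof eventually_elim
    case (elim n)
    have "real n * c - 1 \<le> of_int \<lfloor>real n * c\<rfloor>" by linarith
    then have "(c - 1 / real n) * real n \<le> of_int \<lfloor>real n * c\<rfloor>"
      using elim by (simp add: algebra_simps)
    then show ?case using elim by (simp add: pos_le_divide_eq)
  qed
  show "\<forall>\<^sub>F n in sequentially. of_int \<lfloor>real n * c\<rfloor> / real n \<le> c"
    using eventually_gt_at_top[of 0]
  proof eventually_elim
    case (elim n)
    have "of_int \<lfloor>real n * c\<rfloor> \<le> real n * c" by linarith
    then show ?case using elim by (simp add: field_simps)
  qed
qed simp

text \<open>For finite \<open>c\<close> the criterion \<open>mem\<close> makes the order of
  \<open>x [^] n\<close> the floor of \<open>n * c\<close>; for \<open>c = \<infinity>\<close> the
  order is \<infinity> as soon as \<open>n > 0\<close>. Either way the quotient by \<open>n\<close>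
  tends to \<open>c\<close>.\<close>

lemma asymptotic_samuel_eq:
  assumes c: "0 \<le> c"
    and mem: "\<And>n m. x [^]\<^bsub>R\<^esub> (n::nat) \<in> I m \<longleftrightarrow> ereal (real m) \<le> ereal (real n) * c"
  shows "asymptotic_samuel R I x = c"
proof (cases c)
  case PInf
  have "filtration_order I (x [^]\<^bsub>R\<^esub> n) = \<infinity>" if "0 < n" for n :: nat
  proof -
    have "{m. x [^]\<^bsub>R\<^esub> n \<in> I m} = UNIV" using mem that PInf by simp
    \<comment> \<open>In \<open>enat\<close> an infinite set has supremum \<infinity>, and the set
      here is the image of all naturals under the injective map \<open>enat\<close>.\<close>
    then show ?thesis
      unfolding filtration_order_def Sup_enat_def
      by (auto simp: inj_on_def dest!: finite_imageD)
  qed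
  then have "\<forall>\<^sub>F n in sequentially.
      ereal_of_enat (filtration_order I (x [^]\<^bsub>R\<^esub> n)) / ereal (real n) = c"
    by (intro eventually_mono[OF eventually_gt_at_top[of 0]]) (simp add: PInf)
  then show ?thesis
    unfolding asymptotic_samuel_def by (intro limI tendsto_eventually)
next
  case (real d)
  have "0 \<le> d" using c real by simp
  have "filtration_order I (x [^]\<^bsub>R\<^esub> n) = enat (nat \<lfloor>real n * d\<rfloor>)" for n :: nat
    unfolding filtration_order_def
  proof (rule Sup_eqI)
    fix k assume "k \<in> enat ` {m. x [^]\<^bsub>R\<^esub> n \<in> I m}"
    then show "k \<le> enat (nat \<lfloor>real n * d\<rfloor>)" by (auto simp: mem real le_nat_floor)
  next
    fix k assume *: "\<And>l. l \<in> enat ` {m. x [^]\<^bsub>R\<^esub> n \<in> I m} \<Longrightarrow> l \<le> k"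
    \<comment> \<open>The floor is itself an index \<open>m\<close> with \<open>x [^] n\<close> in
      \<open>I m\<close>, so the supremum is attained.\<close>
    show "enat (nat \<lfloor>real n * d\<rfloor>) \<le> k"
      by (rule *) (use \<open>0 \<le> d\<close> in \<open>auto simp: mem real\<close>)
  qed
  then have "ereal_of_enat (filtration_order I (x [^]\<^bsub>R\<^esub> n)) / ereal (real n)
      = ereal (of_int \<lfloor>real n * d\<rfloor> / real n)" if "0 < n" for n :: nat
    using that \<open>0 \<le> d\<close> by simp
  then have "\<forall>\<^sub>F n in sequentially. ereal (of_int \<lfloor>real n * d\<rfloor> / real n)
      = ereal_of_enat (filtration_order I (x [^]\<^bsub>R\<^esub> n)) / ereal (real n)"
    by (intro eventually_mono[OF eventually_gt_at_top[of 0]]) simp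
  moreover have "(\<lambda>n. ereal (of_int \<lfloor>real n * d\<rfloor> / real n)) \<longlonglongrightarrow> c"
    using tendsto_floor_mult_over[of d] by (simp add: real)
  ultimately show ?thesis
    unfolding asymptotic_samuel_def by (intro limI) (rule Lim_transform_eventually)
qed (use c in simp)

context cring
begin

lemma ereal_valued_hom_divide:
  assumes "discrete_valuation R v" "0 < a"
  shows "ereal_valued_hom R (\<lambda>x. v x / ereal a)"
proof -
  have v: "ereal_valued_hom R v" using assms(1) by (rule discrete_valuation_props)
  have "(v x + v y) / ereal a = v x / ereal a + v y / ereal a"
    if "x \<in> carrier R" "y \<in> carrier R" for x y
    using ereal_valued_homD(2)[OF v that(1)] ereal_valued_homD(2)[OF v that(2)] assms(2)
    by (cases "v x"; cases "v y") (auto simp: add_divide_distrib)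
  then show ?thesis
    using assms(2) ereal_valued_homD[OF v]
    by (auto simp: ereal_valued_hom_def intro!: ereal_divide_right_mono zero_le_divide_ereal)
qed

lemma dv_representation_hom:
  assumes "dv_representation R I s v a" "i \<in> {1..s}"
  shows "ereal_valued_hom R (\<lambda>x. v i x / ereal (a i))"
  using assms by (auto simp: dv_representation_def intro: ereal_valued_hom_divide)

text \<open>Dividing by \<open>a i > 0\<close> turns membership of \<open>x [^] n\<close> in
  \<open>I m\<close> into \<open>m \<le> n * w\<^sub>i x\<close> for all \<open>i\<close>, hence
  into a single inequality for the minimum, as \<open>asymptotic_samuel_eq\<close> requires.\<close>

lemma asymptotic_samuel_dv:
  assumes rep: "dv_representation R I s v a" and x: "x \<in> carrier R"
  shows "asymptotic_samuel R I x = Min ((\<lambda>i. v i x / ereal (a i)) ` {1..s})"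
    (is "_ = Min (?w ` _)")
proof (rule asymptotic_samuel_eq)
  have s: "1 \<le> s" and a: "\<And>i. i \<in> {1..s} \<Longrightarrow> 0 < a i"
    and I: "\<And>m. I m = valuation_inter R {1..s} v a m"
    using rep by (auto simp: dv_representation_def)
  have ne: "?w ` {1..s} \<noteq> {}" using s by auto
  note hom = dv_representation_hom[OF rep]
  show "0 \<le> Min (?w ` {1..s})"
    using ne ereal_valued_homD(2)[OF hom x] by (simp add: Min_ge_iff)
  fix n m :: nat
  have "x [^] n \<in> I m \<longleftrightarrow> (\<forall>i\<in>{1..s}. ereal (a i * real m) \<le> v i (x [^] n))"
    using x by (auto simp: I valuation_inter_def valuation_ideal_def)
  also have "\<dots> \<longleftrightarrow> (\<forall>i\<in>{1..s}. ereal (real m) \<le> v i (x [^] n) / ereal (a i))"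
    using a by (auto simp: ereal_le_divide_pos)
  also have "\<dots> \<longleftrightarrow> (\<forall>i\<in>{1..s}. ereal (real m) \<le> ereal (real n) * ?w i)"
    using ereal_valued_hom_pow[OF hom x] by simp
  also have "\<dots> \<longleftrightarrow> ereal (real m) \<le> ereal (real n) * Min (?w ` {1..s})" (is "?L \<longleftrightarrow> ?R")
  proof
    assume ?L
    moreover have "Min (?w ` {1..s}) \<in> ?w ` {1..s}" using ne by (intro Min_in) auto
    ultimately show ?R by auto
  next
    assume ?R
    moreover have "ereal (real n) * Min (?w ` {1..s}) \<le> ereal (real n) * ?w i"
      if "i \<in> {1..s}" for i
      using that by (intro ereal_mult_left_mono) auto
    ultimately show ?L by (blast intro: order_trans)
  qed
  finally show "x [^] n \<in> I m \<longleftrightarrow> ereal (real m) \<le> ereal (real n) * Min (?w ` {1..s})" .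
qed

section \<open>Recovering the valuations from the asymptotic Samuel function\<close>

text \<open>Some \<open>m\<close> detects the removal of index \<open>i\<close>: an element
  \<open>x\<close> of the larger intersection outside \<open>I m\<close> satisfies
  \<open>w\<^sub>i x < m \<le> w\<^sub>k x\<close> for every other \<open>k\<close>. The threshold
  \<open>m\<close> also makes \<open>w\<^sub>i x\<close> finite.\<close>

lemma irredundant_strict_minimum:
  assumes irr: "irredundant_dv_representation R I s v a" and i: "i \<in> {1..s}"
  obtains x where "x \<in> carrier R" "v i x / ereal (a i) < \<infinity>"
    "\<And>k. k \<in> {1..s} - {i} \<Longrightarrow> v i x / ereal (a i) < v k x / ereal (a k)"
proof -
  have a: "\<And>k. k \<in> {1..s} \<Longrightarrow> 0 < a k" and I: "\<And>m. I m = valuation_inter R {1..s} v a m"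
    using irr by (auto simp: dv_representation_def irredundant_dv_representation_def)
  obtain m where m: "valuation_inter R {1..s} v a m \<noteq> valuation_inter R ({1..s} - {i}) v a m"
    using irr i I unfolding irredundant_dv_representation_def by metis
  have "valuation_inter R {1..s} v a m \<subseteq> valuation_inter R ({1..s} - {i}) v a m"
    by (auto simp: valuation_inter_def)
  then obtain x where x: "x \<in> valuation_inter R ({1..s} - {i}) v a m"
    "x \<notin> valuation_inter R {1..s} v a m"
    using m by blast
  have xc: "x \<in> carrier R" using x(1) by (simp add: valuation_inter_def)
  have ge: "ereal (a k * real m) \<le> v k x" if "k \<in> {1..s} - {i}" for k
    using x(1) that by (auto simp: valuation_inter_def valuation_ideal_def)
  have "\<not> ereal (a i * real m) \<le> v i x"
  proof
    assume "ereal (a i * real m) \<le> v i x"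
    then have "ereal (a k * real m) \<le> v k x" if "k \<in> {1..s}" for k
      using ge that by (cases "k = i") auto
    then show False using x(2) xc by (auto simp: valuation_inter_def valuation_ideal_def)
  qed
  then have less: "v i x / ereal (a i) < ereal (real m)"
    using a[OF i] by (simp add: ereal_divide_less_pos not_le)
  have "ereal (real m) \<le> v k x / ereal (a k)" if "k \<in> {1..s} - {i}" for k
    using ge[OF that] a[of k] that by (simp add: ereal_le_divide_pos)
  then show ?thesis
    using that xc less by (meson less_ereal.simps less_le_trans less_trans less_PInf_Ex_of_nat)
qed

text \<open>Equal asymptotic Samuel functions mean equal pointwise minima of \<open>?w\<close> and
  \<open>?u\<close>, so \<open>strict_minimum_hom_in_family\<close> finds a partner for each index.
  The lemma is one-sided; the theorem applies it in both directions.\<close>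

lemma irredundant_dv_representation_match:
  assumes irr: "irredundant_dv_representation R I s v a"
    and rep: "dv_representation R J r v' a'"
    and eq: "\<forall>x \<in> carrier R. asymptotic_samuel R I x = asymptotic_samuel R J x"
  shows "\<exists>\<sigma>. inj_on \<sigma> {1..s} \<and> \<sigma> ` {1..s} \<subseteq> {1..r} \<and>
    (\<forall>i\<in>{1..s}. a i = a' (\<sigma> i) \<and> (\<forall>x \<in> carrier R. v i x = v' (\<sigma> i) x))"
proof -
  let ?w = "\<lambda>i x. v i x / ereal (a i)" and ?u = "\<lambda>j x. v' j x / ereal (a' j)"
  have rep_I: "dv_representation R I s v a"
    using irr by (simp add: irredundant_dv_representation_def)
  have Min_eq: "Min ((\<lambda>i. ?w i x) ` {1..s}) = Min ((\<lambda>j. ?u j x) ` {1..r})"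
    if "x \<in> carrier R" for x
    using eq that asymptotic_samuel_dv[OF rep_I that] asymptotic_samuel_dv[OF rep that] by simp
  have sr: "1 \<le> s" "1 \<le> r" using rep rep_I by (auto simp: dv_representation_def)
  have wu: "\<exists>j\<in>{1..r}. ?u j x \<le> ?w i x" if "i \<in> {1..s}" "x \<in> carrier R" for i x
  proof -
    have "Min ((\<lambda>j. ?u j x) ` {1..r}) \<in> (\<lambda>j. ?u j x) ` {1..r}" using sr by (intro Min_in) auto
    moreover have "Min ((\<lambda>j. ?u j x) ` {1..r}) \<le> ?w i x"
      using that Min_eq[OF that(2), symmetric] by simp
    ultimately show ?thesis by auto
  qed
  have uw: "\<exists>i\<in>{1..s}. ?w i x \<le> ?u j x" if "j \<in> {1..r}" "x \<in> carrier R" for j x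
  proof -
    have "Min ((\<lambda>i. ?w i x) ` {1..s}) \<in> (\<lambda>i. ?w i x) ` {1..s}" using sr by (intro Min_in) auto
    moreover have "Min ((\<lambda>i. ?w i x) ` {1..s}) \<le> ?u j x"
      using that Min_eq[OF that(2)] by simp
    ultimately show ?thesis by auto
  qed
  have "\<exists>j\<in>{1..r}. \<forall>y\<in>carrier R. ?u j y = ?w i y" if i: "i \<in> {1..s}" for i
  proof -
    obtain x where x: "x \<in> carrier R" "?w i x < \<infinity>"
      "\<And>k. k \<in> {1..s} - {i} \<Longrightarrow> ?w i x < ?w k x"
      using irredundant_strict_minimum[OF irr i] by blast
    show ?thesis
      by (rule strict_minimum_hom_in_family[where A = "{1..s}" and w = ?w and i = i and x = x])
        (use i x wu uw dv_representation_hom[OF rep] dv_representation_hom[OF rep_I] in auto)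
  qed
  then obtain \<sigma> where \<sigma>: "\<And>i. i \<in> {1..s} \<Longrightarrow> \<sigma> i \<in> {1..r}"
    "\<And>i y. i \<in> {1..s} \<Longrightarrow> y \<in> carrier R \<Longrightarrow> ?u (\<sigma> i) y = ?w i y"
    by metis
  \<comment> \<open>Indices with the same partner would have \<open>?w i = ?w k\<close> on
    \<open>R\<close>, yet an element where \<open>?w i\<close> is the strict minimum separates
    them.\<close>
  have "inj_on \<sigma> {1..s}"
  proof (rule inj_onI, rule ccontr)
    fix i k assume ik: "i \<in> {1..s}" "k \<in> {1..s}" "\<sigma> i = \<sigma> k" "i \<noteq> k"
    obtain x where "x \<in> carrier R" "?w i x < ?w k x"
      using irredundant_strict_minimum[OF irr ik(1)] ik by (metis DiffI singletonD)
    then show False using \<sigma>(2)[of i x] \<sigma>(2)[of k x] ik by simp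
  qed
  moreover have "a i = a' (\<sigma> i) \<and> (\<forall>x \<in> carrier R. v i x = v' (\<sigma> i) x)" if i: "i \<in> {1..s}" for i
  proof -
    have dv: "discrete_valuation R (v i)" "discrete_valuation R (v' (\<sigma> i))"
      and pos: "0 < a i" "0 < a' (\<sigma> i)"
      using rep rep_I \<sigma>(1) i by (auto simp: dv_representation_def)
    \<comment> \<open>The normalised value groups fix the scale, so the quotient determines its
      denominator.\<close>
    have a: "a i = a' (\<sigma> i)"
      by (rule discrete_valuation_proportional_imp_eq[OF dv pos]) (use \<sigma>(2) i in blast)
    have "v i x = v' (\<sigma> i) x" if "x \<in> carrier R" for x
    proof -
      have "ereal (a i) * (v i x / ereal (a i)) = ereal (a i) * (v' (\<sigma> i) x / ereal (a i))"
        using \<sigma>(2)[OF i that] a by simp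
      then show ?thesis using pos by (cases "v i x"; cases "v' (\<sigma> i) x") auto
    qed
    with a show ?thesis by blast
  qed
  ultimately show ?thesis using \<sigma>(1) by blast
qed

end

theorem corollary1p6:
  fixes R :: "('a, 'b) ring_scheme"
    and I J :: "nat \<Rightarrow> 'a set"
    and s r :: nat
    and v v' :: "nat \<Rightarrow> 'a \<Rightarrow> ereal"
    and a a' :: "nat \<Rightarrow> real"
  assumes "cring R" and "noetherian_ring R"
    and "discrete_valued_filtration R I" and "discrete_valued_filtration R J"
    and "irredundant_dv_representation R I s v a"
    and "irredundant_dv_representation R J r v' a'"
    and "\<forall>x \<in> carrier R. asymptotic_samuel R I x = asymptotic_samuel R J x"
  shows "r = s \<and>
    (\<exists>\<sigma>. bij_betw \<sigma> {1..s} {1..s} \<and>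
      (\<forall>i\<in>{1..s}. a i = a' (\<sigma> i) \<and> (\<forall>x \<in> carrier R. v i x = v' (\<sigma> i) x)))"
proof -
  interpret cring R by fact
  have rep: "dv_representation R I s v a" "dv_representation R J r v' a'"
    using assms(5,6) by (simp_all add: irredundant_dv_representation_def)
  obtain \<sigma> where \<sigma>: "inj_on \<sigma> {1..s}" "\<sigma> ` {1..s} \<subseteq> {1..r}"
    "\<forall>i\<in>{1..s}. a i = a' (\<sigma> i) \<and> (\<forall>x \<in> carrier R. v i x = v' (\<sigma> i) x)"
    using irredundant_dv_representation_match[OF assms(5) rep(2) assms(7)] by blast
  \<comment> \<open>The reverse matching supplies the inequality \<open>r \<le> s\<close>; the
    reindexing is \<open>\<sigma>\<close>.\<close>
  obtain \<tau> where \<tau>: "inj_on \<tau> {1..r}" "\<tau> ` {1..r} \<subseteq> {1..s}"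
    using irredundant_dv_representation_match[OF assms(6) rep(1)] assms(7) by metis
  have "s \<le> r" "r \<le> s"
    using card_inj_on_le[OF \<sigma>(1,2)] card_inj_on_le[OF \<tau>] by simp_all
  then have "r = s" by simp
  moreover have "bij_betw \<sigma> {1..s} {1..s}"
    using \<sigma>(1,2) \<open>r = s\<close> by (simp add: bij_betw_def endo_inj_surj)
  ultimately show ?thesis using \<sigma>(3) by blast
qed

end
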